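(* Let $k\geq 1$ be an integer. Every $k$-queue graph is: $3k$-choosable with defect $1$, and thus with clustering $2$; $\lfloor\frac{14k+4}{5}\rfloor$-choosable with clustering $9$; and $\lfloor\frac{8k+2}{3}\rfloor$-choosable with clustering at most $152k-13$.
   Context: Graphs are finite and simple. A $k$-queue layout of a graph $G$ consists of a linear ordering $v_1,\dots,v_n$ of $V(G)$ and a partition $E_1,\dots,E_k$ of $E(G)$ such that for each $i$, no two edges in $E_i$ are nested, where edges $v_av_b$ and $v_cv_d$ are nested if $a<c<d<b$. A $k$-queue graph is a graph having a $k$-queue layout. In a coloured graph the monochromatic subgraph is the spanning subgraph of edges whose endpoints have the same colour; its connected components are monochromatic components. A colouring has defect $d$ if the monochromatic subgraph has maximum degree at most $d$, and clustering $c$ if every monochromatic component has at most $c$ vertices. A $k$-list-assignment $L$ assigns to each vertex $v$ a set $L(v)$ of at least $k$ colours; an $L$-colouring colours each $v$ with a colour from $L(v)$. $G$ is $k$-choosable with defect $d$ (resp. clustering $c$) if for every $k$-list-assignment $L$, $G$ has an $L$-colouring with defect $d$ (resp. clustering $c$). *)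

theory Defs
  imports "Graph_Theory.Graph_Theory" "HOL-Library.Disjoint_Sets"
begin

text \<open>
  A finite simple graph is a \<^locale>\<open>pair_graph\<close>: a finite, loopless, symmetric
  relation on the vertices, so the edge joining u and v is the pair of arcs (u,v) and (v,u).
  An edge set is accordingly a symmetric set of arcs, the degree of a vertex is its out-degree,
  and the connected components are the strongly connected components.
\<close>

text \<open>
  Edges are nested with respect to the ordering listed by vs. As F is symmetric, it is
  enough to look at the arcs that are directed from left to right.
\<close>

definition has_nested_edges :: "'a list \<Rightarrow> 'a rel \<Rightarrow> bool" where
  "has_nested_edges vs F \<longleftrightarrow>
     (\<exists>a b c d. a < c \<and> c < d \<and> d < b \<and> b < length vs \<and>
        (vs ! a, vs ! b) \<in> F \<and> (vs ! c, vs ! d) \<in> F)"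

text \<open>As usual for queue layouts, the classes of the edge partition may be empty.\<close>

definition queue_layout ::
  "nat \<Rightarrow> 'a pair_pre_digraph \<Rightarrow> 'a list \<Rightarrow> (nat \<Rightarrow> 'a rel) \<Rightarrow> bool" where
  "queue_layout k G vs E \<longleftrightarrow>
     distinct vs \<and> set vs = pverts G \<and>
     (\<forall>i\<in>{1..k}. sym (E i)) \<and>
     (\<Union>i\<in>{1..k}. E i) = parcs G \<and>
     disjoint_family_on E {1..k} \<and>
     (\<forall>i\<in>{1..k}. \<not> has_nested_edges vs (E i))"

definition queue_graph :: "nat \<Rightarrow> 'a pair_pre_digraph \<Rightarrow> bool" where
  "queue_graph k G \<longleftrightarrow> pair_graph G \<and> (\<exists>vs E. queue_layout k G vs E)"

definition monochromatic_subgraph ::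
  "'a pair_pre_digraph \<Rightarrow> ('a \<Rightarrow> 'c) \<Rightarrow> 'a pair_pre_digraph" where
  "monochromatic_subgraph G f =
     \<lparr> pverts = pverts G, parcs = {(u, v) \<in> parcs G. f u = f v} \<rparr>"

definition has_defect :: "'a pair_pre_digraph \<Rightarrow> ('a \<Rightarrow> 'c) \<Rightarrow> nat \<Rightarrow> bool" where
  "has_defect G f d \<longleftrightarrow>
     (\<forall>v\<in>pverts G. out_degree (with_proj (monochromatic_subgraph G f)) v \<le> d)"

definition monochromatic_components ::
  "'a pair_pre_digraph \<Rightarrow> ('a \<Rightarrow> 'c) \<Rightarrow> ('a, 'a \<times> 'a) pre_digraph set" where
  "monochromatic_components G f =
     pre_digraph.sccs (with_proj (monochromatic_subgraph G f))"

definition has_clustering :: "'a pair_pre_digraph \<Rightarrow> ('a \<Rightarrow> 'c) \<Rightarrow> nat \<Rightarrow> bool" where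
  "has_clustering G f c \<longleftrightarrow> (\<forall>C\<in>monochromatic_components G f. card (verts C) \<le> c)"

text \<open>The lists may be infinite, in which case \<^const>\<open>card\<close> is 0.\<close>

definition list_assignment :: "nat \<Rightarrow> 'a pair_pre_digraph \<Rightarrow> ('a \<Rightarrow> 'c set) \<Rightarrow> bool" where
  "list_assignment k G L \<longleftrightarrow> (\<forall>v\<in>pverts G. infinite (L v) \<or> k \<le> card (L v))"

definition list_colouring ::
  "'a pair_pre_digraph \<Rightarrow> ('a \<Rightarrow> 'c set) \<Rightarrow> ('a \<Rightarrow> 'c) \<Rightarrow> bool" where
  "list_colouring G L f \<longleftrightarrow> (\<forall>v\<in>pverts G. f v \<in> L v)"

text \<open>
  A definition cannot quantify over the type of colours, so it is passed as an argument;
  a type variable there, as in a theorem about an arbitrary \<open>TYPE('c)\<close>,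
  makes the statement range over all types of colours.
\<close>

definition choosable_with_defect ::
  "'c itself \<Rightarrow> nat \<Rightarrow> nat \<Rightarrow> 'a pair_pre_digraph \<Rightarrow> bool" where
  "choosable_with_defect _ k d G \<longleftrightarrow>
     (\<forall>L :: 'a \<Rightarrow> 'c set. list_assignment k G L \<longrightarrow>
        (\<exists>f. list_colouring G L f \<and> has_defect G f d))"

definition choosable_with_clustering ::
  "'c itself \<Rightarrow> nat \<Rightarrow> nat \<Rightarrow> 'a pair_pre_digraph \<Rightarrow> bool" where
  "choosable_with_clustering _ k c G \<longleftrightarrow>
     (\<forall>L :: 'a \<Rightarrow> 'c set. list_assignment k G L \<longrightarrow>
        (\<exists>f. list_colouring G L f \<and> has_clustering G f c))"

end

theory Submission
  imports Defs
begin

text \<open>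
  A \<open>k\<close>-queue graph with \<open>n\<close> vertices has fewer than \<open>2kn\<close> edges, because two edges of one queue
  cannot have the same sum of endpoint positions. So it suffices to treat a graph all of whose
  subgraphs satisfy \<open>4m < 3cn\<close>, with lists of \<open>c\<close> colours.

  Give every vertex one of the roles B, D, X so as to maximise
  \<open>c (6|X| + 4|D|) - 8 e(X,X) - 7 e(X,D) - 6 e(D,D) - 6 e(X,B) - 4 e(D,B)\<close>,
  which is positive when all vertices have role X. Lowering the role of one vertex does not help, so
  with \<open>l(v) = c - deg\<^sub>B(v)\<close> one gets \<open>deg\<^sub>X(v) + deg\<^sub>D(v) < 2 l(v)\<close> on X and
  \<open>deg\<^sub>X(v) + 2 deg\<^sub>D(v) < 4 l(v)\<close> on D. Colour B by induction and
  then X and D, avoiding the colours of neighbours in B and minimising the total weight of the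
  monochromatic edges, where an edge inside D has weight 2 and any other edge weight 1. A vertex
  of X ends up with at most one monochromatic edge and a vertex of D with weight at most 3, so the
  monochromatic components have at most 4 vertices, which is at most 9 and \<open>152k - 13\<close>.
  For defect 1 the two roles B and X suffice, with \<open>2c|X| - 3 e(X,X) - 2 e(X,B)\<close>.
\<close>

section \<open>Two extremal arguments\<close>

text \<open>Only arcs at \<open>v\<close> change their value. Each edge there contributes two arcs
  of equal value by the symmetry of \<open>q\<close>, whence the factor 2. As there are no loops,
  the neighbours of \<open>v\<close> keep their value of \<open>f\<close>.\<close>

lemma sum_arcs_fun_upd:
  fixes q :: "'a \<Rightarrow> 'a \<Rightarrow> 's \<Rightarrow> 's \<Rightarrow> int"
  assumes fin: "finite E" and "sym E" and "irrefl E"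
    and q: "\<And>x y s t. (x, y) \<in> E \<Longrightarrow> q x y s t = q y x t s"
  shows "(\<Sum>(x, y)\<in>E. q x y ((f(v := s)) x) ((f(v := s)) y)) =
    (\<Sum>(x, y)\<in>E. q x y (f x) (f y)) + 2 * (\<Sum>u\<in>E `` {v}. q v u s (f u) - q v u (f v) (f u))"
proof -
  define N where "N = E `` {v}"
  define R where "R = {(x, y) \<in> E. x \<noteq> v \<and> y \<noteq> v}"
  have v: "v \<notin> N"
    using \<open>irrefl E\<close> by (auto simp: N_def irrefl_def)
  have finN: "finite N"
    unfolding N_def using fin by (rule finite_Image)
  have sv: "(x, v) \<in> E \<longleftrightarrow> (v, x) \<in> E" for x
    using \<open>sym E\<close> by (meson symE)
  have qv: "q u v b a = q v u a b" if "u \<in> N" for u a b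
    using q[of v u a b] that by (simp add: N_def)
  have E: "E = R \<union> (Pair v ` N \<union> (\<lambda>u. (u, v)) ` N)"
    by (auto simp: R_def N_def sv)
  have split: "(\<Sum>(x, y)\<in>E. h x y) = (\<Sum>(x, y)\<in>R. h x y) + (\<Sum>u\<in>N. h v u) + (\<Sum>u\<in>N. h u v)"
    for h :: "'a \<Rightarrow> 'a \<Rightarrow> int"
  proof -
    have "finite R"
      using fin E by (metis finite_Un)
    moreover have "R \<inter> (Pair v ` N \<union> (\<lambda>u. (u, v)) ` N) = {}"
      by (auto simp: R_def)
    moreover have "Pair v ` N \<inter> (\<lambda>u. (u, v)) ` N = {}"
      using v by auto
    ultimately have "(\<Sum>(x, y)\<in>E. h x y) = (\<Sum>(x, y)\<in>R. h x y)
        + ((\<Sum>(x, y)\<in>Pair v ` N. h x y) + (\<Sum>(x, y)\<in>(\<lambda>u. (u, v)) ` N. h x y))"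
      using finN by (subst E) (simp add: sum.union_disjoint)
    then show ?thesis
      by (simp add: sum.reindex inj_on_def)
  qed
  have "(\<Sum>(x, y)\<in>R. q x y ((f(v := s)) x) ((f(v := s)) y)) = (\<Sum>(x, y)\<in>R. q x y (f x) (f y))"
    by (rule sum.cong) (auto simp: R_def)
  moreover have "(\<Sum>u\<in>N. q v u ((f(v := s)) v) ((f(v := s)) u)) = (\<Sum>u\<in>N. q v u s (f u))"
    using v by (intro sum.cong) auto
  moreover have "(\<Sum>u\<in>N. q u v ((f(v := s)) u) ((f(v := s)) v)) = (\<Sum>u\<in>N. q v u s (f u))"
    using v by (intro sum.cong) (auto simp: qv)
  moreover have "(\<Sum>u\<in>N. q u v (f u) (f v)) = (\<Sum>u\<in>N. q v u (f v) (f u))"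
    by (intro sum.cong) (simp_all add: qv)
  ultimately show ?thesis
    by (simp add: split sum_subtractf flip: N_def)
qed

text \<open>The constant role \<open>r\<close> has positive value by \<open>dens\<close>, which
  rules out the all-zero assignment, of value 0, as an optimum. The last conclusion is local
  optimality against lowering one role by 1. The factor 2 before \<open>P\<close> matches an arc sum
  that counts every edge twice.\<close>

lemma role_optimum:
  fixes Q :: "nat \<Rightarrow> nat \<Rightarrow> int" and P :: "nat \<Rightarrow> int"
  assumes V: "finite V" and E: "E \<subseteq> V \<times> V" "sym E" "irrefl E"
    and Qsym: "\<And>i j. Q i j = Q j i" and zero: "Q 0 0 = 0" "P 0 = 0"
    and dens: "Q r r * int (card E) < 2 * P r * int (card V)"
  obtains \<rho> where "\<And>v. v \<in> V \<Longrightarrow> \<rho> v \<le> r" "\<exists>v\<in>V. \<rho> v \<noteq> 0"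
    "\<And>v. v \<in> V \<Longrightarrow> \<rho> v \<noteq> 0 \<Longrightarrow>
      (\<Sum>u\<in>E `` {v}. Q (\<rho> v) (\<rho> u) - Q (\<rho> v - 1) (\<rho> u)) < P (\<rho> v) - P (\<rho> v - 1)"
proof -
  define g where "g \<rho> = 2 * (\<Sum>v\<in>V. P (\<rho> v)) - (\<Sum>(x, y)\<in>E. Q (\<rho> x) (\<rho> y))" for \<rho> :: "'a \<Rightarrow> nat"
  \<comment> \<open>The subtracted sum breaks ties, so that lowering a role makes g strictly smaller.\<close>
  define \<Phi> where "\<Phi> \<rho> = (int r * int (card V) + 1) * g \<rho> - (\<Sum>v\<in>V. int (\<rho> v))" for \<rho>
  define F where "F = V \<rightarrow>\<^sub>E {..r}"
  have finE: "finite E"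
    using E(1) V by (meson finite_SigmaI finite_subset)
  have finF: "finite F"
    unfolding F_def using V by (intro finite_PiE) auto
  have top: "(\<lambda>v\<in>V. r) \<in> F"
    by (auto simp: F_def)
  then have "Max (\<Phi> ` F) \<in> \<Phi> ` F"
    using finF by (intro Max_in) auto
  then obtain \<rho> where \<rho>: "\<rho> \<in> F" "\<Phi> \<rho> = Max (\<Phi> ` F)"
    by auto
  then have max: "\<Phi> \<sigma> \<le> \<Phi> \<rho>" if "\<sigma> \<in> F" for \<sigma>
    using finF that by simp
  have "g (\<lambda>v\<in>V. r) = 2 * P r * int (card V) - (\<Sum>(x, y)\<in>E. Q r r)"
  proof -
    have "(\<Sum>(x, y)\<in>E. Q ((\<lambda>v\<in>V. r) x) ((\<lambda>v\<in>V. r) y)) = (\<Sum>(x, y)\<in>E. Q r r)"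
      using E(1) by (intro sum.cong) auto
    then show ?thesis
      by (simp add: g_def)
  qed
  \<comment> \<open>Since \<open>g\<close> is integer valued, positive means at least 1. Multiplied
    by \<open>r * card V + 1\<close> it outweighs the tie-breaking sum, which equals
    \<open>r * card V\<close> here.\<close>
  then have "1 \<le> g (\<lambda>v\<in>V. r)"
    using dens by (simp add: case_prod_unfold mult.commute)
  then have "int r * int (card V) + 1 \<le> (int r * int (card V) + 1) * g (\<lambda>v\<in>V. r)"
    by (metis mult.right_neutral mult_left_mono of_nat_0_le_iff add_increasing2 of_nat_mult zero_le_one add_nonneg_nonneg)
  then have "1 \<le> (int r * int (card V) + 1) * g (\<lambda>v\<in>V. r) - int r * int (card V)"
    by linarith
  also have "\<dots> = \<Phi> (\<lambda>v\<in>V. r)"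
    by (simp add: \<Phi>_def)
  finally have "1 \<le> \<Phi> (\<lambda>v\<in>V. r)" .
  then have pos: "0 < \<Phi> \<rho>"
    using max[OF top] by simp
  show ?thesis
  proof
    show le: "\<rho> v \<le> r" if "v \<in> V" for v
      using \<rho>(1) that by (auto simp: F_def PiE_def Pi_def)
    show "\<exists>v\<in>V. \<rho> v \<noteq> 0"
    proof (rule ccontr)
      assume "\<not> ?thesis"
      then have "\<rho> x = 0" "\<rho> y = 0" if "(x, y) \<in> E" for x y
        using that E(1) by auto
      then have "(\<Sum>(x, y)\<in>E. Q (\<rho> x) (\<rho> y)) = 0"
        using zero by (auto intro: sum.neutral)
      with \<open>\<not> ?thesis\<close> have "\<Phi> \<rho> = 0"
        by (simp add: \<Phi>_def g_def zero)
      with pos show False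
        by simp
    qed
    fix v assume v: "v \<in> V" "\<rho> v \<noteq> 0"
    let ?i = "\<rho> v - 1"
    let ?\<sigma> = "\<rho>(v := ?i)"
    have upd: "(\<Sum>x\<in>V. h (?\<sigma> x)) = (\<Sum>x\<in>V. h (\<rho> x)) + h ?i - h (\<rho> v)" for h :: "nat \<Rightarrow> int"
      using V v by (simp add: sum.remove[of V v])
    have "?\<sigma> \<in> F"
      using \<rho>(1) v le[OF v(1)] by (auto simp: F_def PiE_def Pi_def extensional_def)
    from max[OF this]
    have "(int r * int (card V) + 1) * (g ?\<sigma> - g \<rho>) < 0"
      using v(2) upd[of int] by (simp add: \<Phi>_def algebra_simps)
    then have "g ?\<sigma> < g \<rho>"
      by (smt (verit) mult_nonneg_nonneg of_nat_0_le_iff)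
    moreover have "(\<Sum>(x, y)\<in>E. Q (?\<sigma> x) (?\<sigma> y)) = (\<Sum>(x, y)\<in>E. Q (\<rho> x) (\<rho> y))
        + 2 * (\<Sum>u\<in>E `` {v}. Q ?i (\<rho> u) - Q (\<rho> v) (\<rho> u))"
      using finE E(2,3) Qsym by (intro sum_arcs_fun_upd)
    ultimately have "P ?i - P (\<rho> v) < (\<Sum>u\<in>E `` {v}. Q ?i (\<rho> u) - Q (\<rho> v) (\<rho> u))"
      using upd[of P] by (simp add: g_def)
    then show "(\<Sum>u\<in>E `` {v}. Q (\<rho> v) (\<rho> u) - Q ?i (\<rho> u)) < P (\<rho> v) - P ?i"
      by (simp add: sum_subtractf)
  qed
qed

text \<open>
  Lovasz's argument: minimise the total weight of the monochromatic edges.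
\<close>

lemma weighted_defective_colouring:
  fixes w :: "'a \<Rightarrow> 'a \<Rightarrow> int" and \<kappa> :: "'a \<Rightarrow> int" and L :: "'a \<Rightarrow> 'c set"
  assumes fin: "finite E" and E: "sym E" "irrefl E"
    and wsym: "\<And>x y. (x, y) \<in> E \<Longrightarrow> w x y = w y x"
    and wnn: "\<And>x y. (x, y) \<in> E \<Longrightarrow> 0 \<le> w x y"
    and lists: "\<And>v. v \<in> A \<Longrightarrow> \<exists>C\<subseteq>L v. finite C \<and> (\<Sum>u\<in>E `` {v}. w v u) < \<kappa> v * int (card C)"
  obtains f where "\<And>v. v \<in> A \<Longrightarrow> f v \<in> L v"
    "\<And>v. v \<in> A \<Longrightarrow> (\<Sum>u\<in>E `` {v}. if f u = f v then w v u else 0) < \<kappa> v"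
proof -
  define \<E> where "\<E> f = (\<Sum>(x, y)\<in>E. if f x = f y then w x y else 0)" for f :: "'a \<Rightarrow> 'c"
  have \<E>_nonneg: "0 \<le> \<E> f" for f
    unfolding \<E>_def using wnn by (auto intro!: sum_nonneg)
  have light: "\<exists>c\<in>L v. (\<Sum>u\<in>E `` {v}. if f u = c then w v u else 0) < \<kappa> v" if v: "v \<in> A" for v and f :: "'a \<Rightarrow> 'c"
  proof (rule ccontr)
    assume neg: "\<not> ?thesis"
    obtain C where C: "C \<subseteq> L v" "finite C" and less: "(\<Sum>u\<in>E `` {v}. w v u) < \<kappa> v * int (card C)"
      using lists[OF v] by blast
    \<comment> \<open>Averaging over \<open>C\<close>: the weight of a neighbour is charged to at
      most one colour, its own. If all colours of \<open>C\<close> were heavy, the neighbours would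
      weigh at least \<open>\<kappa> v * card C\<close> together.\<close>
    have "\<kappa> v * int (card C) = (\<Sum>c\<in>C. \<kappa> v)"
      by simp
    also have "\<dots> \<le> (\<Sum>c\<in>C. \<Sum>u\<in>E `` {v}. if f u = c then w v u else 0)"
      using neg C(1) by (intro sum_mono) (meson not_le subsetD)
    also have "\<dots> = (\<Sum>u\<in>E `` {v}. \<Sum>c\<in>C. if f u = c then w v u else 0)"
      by (rule sum.swap)
    also have "\<dots> \<le> (\<Sum>u\<in>E `` {v}. w v u)"
      using C(2) wnn by (intro sum_mono) auto
    finally show False
      using less by simp
  qed
  then have "\<forall>v\<in>A. \<exists>c. c \<in> L v"
    by blast
  then have "\<exists>f. \<forall>v\<in>A. f v \<in> L v"
    by (rule bchoice)
  \<comment> \<open>The energy is a nonnegative integer, so a least value exists and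
    \<open>nat\<close> loses nothing.\<close>
  then obtain f where f: "\<forall>v\<in>A. f v \<in> L v"
    and min: "\<And>h. \<forall>v\<in>A. h v \<in> L v \<Longrightarrow> nat (\<E> f) \<le> nat (\<E> h)"
    using ex_has_least_nat[of "\<lambda>f. \<forall>v\<in>A. f v \<in> L v" _ "\<lambda>f. nat (\<E> f)"] by blast
  show ?thesis
  proof
    fix v assume v: "v \<in> A"
    then show "f v \<in> L v"
      using f by blast
    show "(\<Sum>u\<in>E `` {v}. if f u = f v then w v u else 0) < \<kappa> v"
    proof (rule ccontr)
      assume heavy: "\<not> ?thesis"
      obtain c where c: "c \<in> L v" "(\<Sum>u\<in>E `` {v}. if f u = c then w v u else 0) < \<kappa> v"
        using light[OF v] by blast
      \<comment> \<open>Moving \<open>v\<close> to a light colour changes the energy by twice the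
        difference of the two monochromatic weights at \<open>v\<close>, which contradicts
        minimality.\<close>
      have "\<E> (f(v := c)) = \<E> f + 2 * (\<Sum>u\<in>E `` {v}.
          (if c = f u then w v u else 0) - (if f v = f u then w v u else 0))"
        unfolding \<E>_def using fin E
        by (intro sum_arcs_fun_upd[where q = "\<lambda>x y s t. if s = t then w x y else 0"])
          (auto intro: wsym)
      then have "\<E> (f(v := c)) < \<E> f"
        using heavy c(2) by (simp add: sum_subtractf eq_commute cong: if_cong)
      moreover have "\<E> f \<le> \<E> (f(v := c))"
        using min[of "f(v := c)"] f c(1) \<E>_nonneg by (simp add: nat_le_eq_zle)
      ultimately show False
        by simp
    qed
  qed
qed

section \<open>Colouring layer by layer\<close>

text \<open>
  Role 0 marks the vertices that are left to the induction hypothesis, and w i 0 is what such a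
  neighbour costs a vertex of role i: it removes at most one of the c colours.
\<close>

lemma role_colouring:
  fixes Q :: "nat \<Rightarrow> nat \<Rightarrow> int" and E :: "'a rel" and L :: "'a \<Rightarrow> 'c set"
  defines "w \<equiv> \<lambda>i j. Q i j - Q (i - 1) j"
  assumes Qsym: "\<And>i j. Q i j = Q j i" and Q0: "Q 0 0 = 0"
    and wsym: "\<And>i j. \<lbrakk>i \<in> {1..r}; j \<in> {1..r}\<rbrakk> \<Longrightarrow> w i j = w j i"
    and wnn: "\<And>i j. \<lbrakk>i \<in> {1..r}; j \<in> {0..r}\<rbrakk> \<Longrightarrow> 0 \<le> w i j"
    and E: "sym E" "irrefl E"
    and "finite V"
    and "\<And>W. \<lbrakk>W \<subseteq> V; W \<noteq> {}\<rbrakk> \<Longrightarrow>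
      Q r r * int (card (E \<inter> W \<times> W)) < 2 * (int c * Q r 0) * int (card W)"
    and "\<And>v. v \<in> V \<Longrightarrow> infinite (L v) \<or> c \<le> card (L v)"
  shows "\<exists>f \<rho>. \<forall>v\<in>V. f v \<in> L v \<and> \<rho> v \<in> {1..r} \<and>
    (\<Sum>u\<in>(E \<inter> V \<times> V) `` {v}. if f u = f v then w (\<rho> v) (\<rho> u) else 0) < w (\<rho> v) 0"
  using assms(8-10)
proof (induction V rule: finite_psubset_induct)
  case (psubset V)
  show ?case
  proof (cases "V = {}")
    case False
    let ?E = "E \<inter> V \<times> V"
    have sE: "sym (E \<inter> W \<times> W)" and iE: "irrefl (E \<inter> W \<times> W)" for W
      using E by (auto simp: sym_def irrefl_def)
    \<comment> \<open>With \<open>P i = c * Q i 0\<close>, local optimality says that the weights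
      \<open>w (\<rho> v) (\<rho> u)\<close> over all neighbours in \<open>V\<close> sum to less
      than \<open>c * w (\<rho> v) 0\<close>.\<close>
    obtain \<rho> where \<rho>: "\<And>v. v \<in> V \<Longrightarrow> \<rho> v \<le> r" and ne: "\<exists>v\<in>V. \<rho> v \<noteq> 0"
      and opt: "\<And>v. v \<in> V \<Longrightarrow> \<rho> v \<noteq> 0 \<Longrightarrow>
        (\<Sum>u\<in>?E `` {v}. Q (\<rho> v) (\<rho> u) - Q (\<rho> v - 1) (\<rho> u))
          < int c * Q (\<rho> v) 0 - int c * Q (\<rho> v - 1) 0"
      using role_optimum[of V ?E Q "\<lambda>i. int c * Q i 0" r]
        psubset.hyps sE iE Qsym Q0 psubset.prems(1)[OF subset_refl False] by (auto simp: mult_ac)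
    define A where "A = {v \<in> V. \<rho> v \<noteq> 0}"
    define B where "B = V - A"
    have roleA: "\<rho> v \<in> {1..r}" if "v \<in> A" for v
      using that \<rho>[of v] by (auto simp: A_def)
    have AV: "A \<subseteq> V" and BV: "B \<subseteq> V" and VAB: "V = A \<union> B" and disj: "A \<inter> B = {}"
      by (auto simp: A_def B_def)
    have "B \<subset> V"
      using ne by (auto simp: A_def B_def)
    \<comment> \<open>The density hypothesis speaks of all nonempty subsets and so passes to
      \<open>B\<close>, where the roles \<open>\<sigma>\<close> replace role 0.\<close>
    have "\<exists>g \<sigma>. \<forall>v\<in>B. g v \<in> L v \<and> \<sigma> v \<in> {1..r} \<and>
        (\<Sum>u\<in>(E \<inter> B \<times> B) `` {v}. if g u = g v then w (\<sigma> v) (\<sigma> u) else 0) < w (\<sigma> v) 0"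
      using psubset.prems BV by (intro psubset.IH[OF \<open>B \<subset> V\<close>]) auto
    then obtain g \<sigma> where g: "\<And>v. v \<in> B \<Longrightarrow> g v \<in> L v" "\<And>v. v \<in> B \<Longrightarrow> \<sigma> v \<in> {1..r}"
      "\<And>v. v \<in> B \<Longrightarrow>
        (\<Sum>u\<in>(E \<inter> B \<times> B) `` {v}. if g u = g v then w (\<sigma> v) (\<sigma> u) else 0) < w (\<sigma> v) 0"
      by blast
    define NB where "NB v = (E `` {v}) \<inter> B" for v
    have finN: "finite (E `` {v} \<inter> W)" if "W \<subseteq> V" for v W
      using psubset.hyps that by (meson finite_Int finite_subset)
    have nb: "?E `` {v} = (E \<inter> A \<times> A) `` {v} \<union> NB v"
        "(E \<inter> A \<times> A) `` {v} \<inter> NB v = {}" if "v \<in> A" for v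
      using that VAB disj by (auto simp: NB_def)
    have "\<exists>C\<subseteq>L v - g ` NB v. finite C \<and>
        (\<Sum>u\<in>(E \<inter> A \<times> A) `` {v}. w (\<rho> v) (\<rho> u)) < w (\<rho> v) 0 * int (card C)"
      if v: "v \<in> A" for v
    proof -
      \<comment> \<open>A list may be infinite, so exactly \<open>c\<close> of its colours are
        kept.\<close>
      obtain D where D: "D \<subseteq> L v" "finite D" "card D = c"
      proof (cases "finite (L v)")
        case True
        then show ?thesis
          using psubset.prems(2)[of v] v AV obtain_subset_with_card_n[of c "L v"] that
          by (metis subsetD)
      next
        case False
        then show ?thesis
          using infinite_arbitrarily_large[of "L v" c] that by blast
      qed
      let ?C = "D - g ` NB v"
      have fin: "finite (NB v)" "finite ((E \<inter> A \<times> A) `` {v})"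
        using finN[OF BV] finN[OF AV] by (auto simp: NB_def intro: finite_subset[rotated])
      have "int c - int (card (NB v)) \<le> int (card ?C)"
        using D diff_card_le_card_Diff[of "g ` NB v" D] card_image_le[OF fin(1), of g] fin by simp
      then have "w (\<rho> v) 0 * (int c - int (card (NB v))) \<le> w (\<rho> v) 0 * int (card ?C)"
        using wnn[OF roleA[OF v], of 0] by (intro mult_left_mono) auto
      \<comment> \<open>Neighbours in \<open>B\<close> have role 0. Removing their share from the
        optimality bound leaves at most \<open>w (\<rho> v) 0\<close> for each surviving
        colour.\<close>
      moreover have "(\<Sum>u\<in>NB v. w (\<rho> v) (\<rho> u)) = (\<Sum>u\<in>NB v. w (\<rho> v) 0)"
        by (intro sum.cong) (auto simp: NB_def A_def B_def)
      moreover have "(\<Sum>u\<in>?E `` {v}. w (\<rho> v) (\<rho> u)) < int c * w (\<rho> v) 0"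
        using opt[of v] v by (simp add: A_def w_def right_diff_distrib)
      ultimately have "(\<Sum>u\<in>(E \<inter> A \<times> A) `` {v}. w (\<rho> v) (\<rho> u)) < w (\<rho> v) 0 * int (card ?C)"
        using nb[OF v] fin by (simp add: sum.union_disjoint algebra_simps)
      then show ?thesis
        using D by (intro exI[of _ ?C]) auto
    qed
    then obtain h where h: "\<And>v. v \<in> A \<Longrightarrow> h v \<in> L v - g ` NB v"
      "\<And>v. v \<in> A \<Longrightarrow>
        (\<Sum>u\<in>(E \<inter> A \<times> A) `` {v}. if h u = h v then w (\<rho> v) (\<rho> u) else 0) < w (\<rho> v) 0"
    proof (rule weighted_defective_colouring[of "E \<inter> A \<times> A" "\<lambda>v u. w (\<rho> v) (\<rho> u)"
          A "\<lambda>v. L v - g ` NB v" "\<lambda>v. w (\<rho> v) 0", rotated -2])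
      show "finite (E \<inter> A \<times> A)"
        using psubset.hyps AV by (meson finite_Int finite_SigmaI finite_subset)
      show "w (\<rho> x) (\<rho> y) = w (\<rho> y) (\<rho> x)" "0 \<le> w (\<rho> x) (\<rho> y)" if "(x, y) \<in> E \<inter> A \<times> A" for x y
        using that roleA[of x] roleA[of y] wsym[of "\<rho> x" "\<rho> y"] wnn[of "\<rho> x" "\<rho> y"] by auto
    qed (use sE iE in auto)
    define f where "f v = (if v \<in> A then h v else g v)" for v
    define \<tau> where "\<tau> v = (if v \<in> A then \<rho> v else \<sigma> v)" for v
    \<comment> \<open>As \<open>h\<close> avoids the colours of \<open>g\<close> on neighbours in
      \<open>B\<close>, no edge between \<open>A\<close> and \<open>B\<close> is monochromatic.
      Hence the bounds obtained inside \<open>A\<close> and inside \<open>B\<close> remain valid in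
      \<open>V\<close>.\<close>
    have cross: "f u \<noteq> f v" if "v \<in> A" "u \<in> B" "(u, v) \<in> E \<or> (v, u) \<in> E" for u v
    proof -
      have "u \<in> NB v"
        using that E(1) by (auto simp: NB_def dest: symD)
      then show ?thesis
        using h(1)[OF that(1)] that disj by (auto simp: f_def intro: rev_image_eqI)
    qed
    have restrict: "(\<Sum>u\<in>?E `` {v}. if f u = f v then w (\<tau> v) (\<tau> u) else 0) =
        (\<Sum>u\<in>(E \<inter> W \<times> W) `` {v}. if f u = f v then w (\<tau> v) (\<tau> u) else 0)"
      if "v \<in> W" "W = A \<or> W = B" for v W
    proof (rule sum.mono_neutral_right)
      show "finite (?E `` {v})"
        using finN[OF subset_refl, of v] by (rule finite_subset[rotated]) auto
      show "(E \<inter> W \<times> W) `` {v} \<subseteq> ?E `` {v}"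
        using that AV BV by auto
      show "\<forall>u\<in>?E `` {v} - (E \<inter> W \<times> W) `` {v}. (if f u = f v then w (\<tau> v) (\<tau> u) else 0) = 0"
        using that VAB cross by (auto; metis)
    qed
    have "f v \<in> L v \<and> \<tau> v \<in> {1..r} \<and>
        (\<Sum>u\<in>?E `` {v}. if f u = f v then w (\<tau> v) (\<tau> u) else 0) < w (\<tau> v) 0" if "v \<in> V" for v
    proof (cases "v \<in> A")
      case True
      have "(\<Sum>u\<in>(E \<inter> A \<times> A) `` {v}. if f u = f v then w (\<tau> v) (\<tau> u) else 0) =
          (\<Sum>u\<in>(E \<inter> A \<times> A) `` {v}. if h u = h v then w (\<rho> v) (\<rho> u) else 0)"
        by (intro sum.cong) (auto simp: f_def \<tau>_def)
      then show ?thesis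
        using True restrict[of v A] h[of v] roleA[of v] by (auto simp: f_def \<tau>_def)
    next
      case False
      then have v: "v \<in> B"
        using that VAB by blast
      have "(\<Sum>u\<in>(E \<inter> B \<times> B) `` {v}. if f u = f v then w (\<tau> v) (\<tau> u) else 0) =
          (\<Sum>u\<in>(E \<inter> B \<times> B) `` {v}. if g u = g v then w (\<sigma> v) (\<sigma> u) else 0)"
        using disj by (intro sum.cong) (auto simp: f_def \<tau>_def)
      then show ?thesis
        using False v restrict[of v B] g[of v] by (simp add: f_def \<tau>_def)
    qed
    then show ?thesis
      by blast
  qed simp
qed

section \<open>Queue layouts are sparse\<close>

text \<open>The sum of the end ranks determines an edge and takes fewer than
  \<open>2 * card W\<close> values. This leaves at most \<open>2 * card W - 1\<close> edges, each
  with two arcs.\<close>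

lemma card_unnested_arcs:
  assumes W: "finite W" "W \<noteq> {}" "W \<subseteq> set vs"
    and F: "sym F" "irrefl F" "\<not> has_nested_edges vs F"
  shows "card (F \<inter> W \<times> W) < 4 * card W"
proof -
  have "\<forall>x\<in>W. \<exists>i. i < length vs \<and> vs ! i = x"
    using W(3) by (auto simp: in_set_conv_nth)
  then obtain pos where "\<forall>x\<in>W. pos x < length vs \<and> vs ! pos x = x"
    by (rule bchoice[THEN exE])
  then have pos: "pos x < length vs" "vs ! pos x = x" if "x \<in> W" for x
    using that by blast+
  \<comment> \<open>Ranks inside \<open>W\<close> order its vertices like positions in
    \<open>vs\<close>, but stay below \<open>card W\<close>, so the count does not depend on the
    length of \<open>vs\<close>.\<close>
  define rk where "rk x = card {y \<in> W. pos y < pos x}" for x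
  have rk_less: "rk x < rk y" if "x \<in> W" "pos x < pos y" for x y
    unfolding rk_def using W(1) that by (intro psubset_card_mono) auto
  have rk_card: "rk x < card W" if "x \<in> W" for x
    unfolding rk_def using W(1) that by (intro psubset_card_mono) auto
  have pos_eq: "x = y" if "x \<in> W" "y \<in> W" "rk x = rk y" for x y
    using rk_less[of x y] rk_less[of y x] pos[of x] pos[of y] that
    by (metis less_irrefl linorder_neqE_nat)
  define R where "R = {(x, y) \<in> F \<inter> W \<times> W. pos x < pos y}"
  \<comment> \<open>Of two arcs with the same sum of ranks, one would be nested in the other.\<close>
  have less_if: "\<not> rk a < rk c"
    if "(a, b) \<in> R" "(c, d) \<in> R" "rk a + rk b = rk c + rk d" for a b c d
  proof
    assume "rk a < rk c"
    have in_W: "a \<in> W" "b \<in> W" "c \<in> W" "d \<in> W" and arcs: "(a, b) \<in> F" "(c, d) \<in> F"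
      and cd: "pos c < pos d"
      using that by (auto simp: R_def)
    have "rk d < rk b"
      using \<open>rk a < rk c\<close> that(3) by linarith
    then have "pos d < pos b" "pos a < pos c"
      using rk_less[of b d] rk_less[of c a] \<open>rk a < rk c\<close> in_W pos
      by (metis less_asym less_irrefl linorder_neqE_nat)+
    then have "has_nested_edges vs F"
      unfolding has_nested_edges_def using in_W arcs cd pos
      by (intro exI[of _ "pos a"] exI[of _ "pos b"] exI[of _ "pos c"] exI[of _ "pos d"]) simp
    with F(3) show False
      by contradiction
  qed
  have "inj_on (\<lambda>(x, y). rk x + rk y) R"
  proof (rule inj_onI, clarify)
    fix a b c d assume *: "(a, b) \<in> R" "(c, d) \<in> R" "rk a + rk b = rk c + rk d"
    then have "rk a = rk c" "rk b = rk d"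
      using less_if[of a b c d] less_if[of c d a b] by linarith+
    then show "a = c \<and> b = d"
      using * pos_eq by (auto simp: R_def)
  qed
  moreover have "(\<lambda>(x, y). rk x + rk y) ` R \<subseteq> {..<2 * card W - 1}"
    using rk_card rk_less by (fastforce simp: R_def)
  ultimately have "card R \<le> 2 * card W - 1"
    using card_inj_on_le[of _ R "{..<2 * card W - 1}"] by simp
  moreover have "F \<inter> W \<times> W = R \<union> R\<inverse>"
  proof -
    have "pos x \<noteq> pos y" if "(x, y) \<in> F" "x \<in> W" "y \<in> W" for x y
      using that pos F(2) by (metis irrefl_def)
    then show ?thesis
      using F(1) by (auto simp: R_def dest: symD linorder_neqE_nat)
  qed
  moreover have "card (R \<union> R\<inverse>) \<le> card R + card R"
    using card_Un_le[of R "R\<inverse>"] by simp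
  moreover have "0 < card W"
    using W by (simp add: card_gt_0_iff)
  ultimately show ?thesis
    by simp
qed

text \<open>The bounds for the single queues add up. Arbitrary nonempty \<open>W\<close> are treated
  because the colouring is built by recursion on vertex subsets.\<close>

lemma queue_graph_sparse:
  assumes k: "1 \<le> k" and G: "queue_graph k G" and W: "W \<subseteq> pverts G" "W \<noteq> {}"
  shows "card (parcs G \<inter> W \<times> W) < 4 * k * card W"
proof -
  obtain vs E where lay: "queue_layout k G vs E" and "pair_graph G"
    using G by (auto simp: queue_graph_def)
  interpret pair_graph G by fact
  have fin: "finite W"
    using W(1) pair_finite_verts by (rule finite_subset)
  have E: "parcs G = (\<Union>i\<in>{1..k}. E i)"
    using lay by (simp add: queue_layout_def)
  have "card (parcs G \<inter> W \<times> W) = card (\<Union>i\<in>{1..k}. E i \<inter> W \<times> W)"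
    by (simp add: E Int_UN_distrib2)
  also have "\<dots> \<le> (\<Sum>i\<in>{1..k}. card (E i \<inter> W \<times> W))"
    by (rule card_UN_le) simp
  \<comment> \<open>The sum inherits strictness because the index set is nonempty.\<close>
  also have "\<dots> < (\<Sum>i\<in>{1..k}. 4 * card W)"
  proof (rule sum_strict_mono)
    fix i assume i: "i \<in> {1..k}"
    have "irrefl (E i)"
      using pair_no_loops E i by (fastforce simp: irrefl_def)
    then show "card (E i \<inter> W \<times> W) < 4 * card W"
      using lay i W fin by (intro card_unnested_arcs[where vs = vs]) (auto simp: queue_layout_def)
  qed (use k in auto)
  finally show ?thesis
    by (simp add: mult_ac)
qed

section \<open>Monochromatic components\<close>

text \<open>A set that contains \<open>v\<close> and is closed under monochromatic arcs contains all
  that is reachable from \<open>v\<close>. Exhibiting such small sets avoids determining the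
  components exactly.\<close>

lemma has_clusteringI:
  assumes closed: "\<And>v. v \<in> pverts G \<Longrightarrow> \<exists>C. v \<in> C \<and> finite C \<and> card C \<le> c \<and>
      {(x, y) \<in> parcs G. f x = f y} `` C \<subseteq> C"
  shows "has_clustering G f c"
  unfolding has_clustering_def
proof
  let ?M = "with_proj (monochromatic_subgraph G f)"
  fix H assume "H \<in> monochromatic_components G f"
  then have ind: "induced_subgraph H ?M" and con: "strongly_connected H"
    by (auto simp: monochromatic_components_def pre_digraph.sccs_def)
  have sub: "subgraph H ?M"
    using ind by (rule induced_imp_subgraph)
  then have arcs: "arcs_ends H \<subseteq> {(x, y) \<in> parcs G. f x = f y}"
    using arcs_ends_mono[OF sub] by (simp add: monochromatic_subgraph_def)
  obtain v where v: "v \<in> verts H"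
    using con by (auto simp: strongly_connected_def)
  then have "v \<in> pverts G"
    using subgraph_imp_subverts[OF sub] by (auto simp: monochromatic_subgraph_def)
  then obtain C where C: "v \<in> C" "finite C" "card C \<le> c"
      "{(x, y) \<in> parcs G. f x = f y} `` C \<subseteq> C"
    using closed by blast
  have "u \<in> C" if "u \<in> verts H" for u
  proof -
    have "(v, u) \<in> rtrancl_on (verts H) (arcs_ends H)"
      using con v that by (auto simp: strongly_connected_def reachable_def)
    then show ?thesis
    proof (induction rule: rtrancl_on_induct)
      case base
      show ?case
        by fact
    next
      case (step y z)
      then show ?case
        using arcs C(4) by blast
    qed
  qed
  then show "card (verts H) \<le> c"
    using C(2,3) card_mono[of C "verts H"] by fastforce
qed

lemma has_defect_iff:
  "has_defect G f d \<longleftrightarrow> (\<forall>v\<in>pverts G. card {u. (v, u) \<in> parcs G \<and> f u = f v} \<le> d)"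
proof -
  have "out_arcs (with_proj (monochromatic_subgraph G f)) v =
      Pair v ` {u. (v, u) \<in> parcs G \<and> f u = f v}" for v
    by (auto simp: out_arcs_def monochromatic_subgraph_def)
  then show ?thesis
    by (simp add: has_defect_def out_degree_def card_image inj_on_def)
qed

text \<open>If \<open>v\<close> has a monochromatic neighbour \<open>u\<close>, then by symmetry
  \<open>v\<close> is the only one of \<open>u\<close>. So \<open>v\<close> with its neighbours is
  closed and has at most two elements.\<close>

lemma defect_1_imp_clustering_2:
  assumes G: "pair_graph G" and f: "has_defect G f 1"
  shows "has_clustering G f 2"
proof -
  interpret pair_graph G by fact
  let ?N = "\<lambda>v. {u. (v, u) \<in> parcs G \<and> f u = f v}"
  have fin: "finite (?N v)" for v
    using pair_finite_verts by (rule finite_subset[rotated]) (auto simp: in_arcsD2)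
  have sym: "u \<in> ?N v \<Longrightarrow> v \<in> ?N u" for u v
    using arcs_symmetric by auto
  show ?thesis
  proof (rule has_clusteringI)
    fix v assume v: "v \<in> pverts G"
    have le: "card (?N u) \<le> 1" if "u \<in> pverts G" for u
      using f that by (simp add: has_defect_iff)
    have "?N u \<subseteq> {v}" if "u \<in> ?N v" for u
    proof -
      have "u \<in> pverts G"
        using that by (auto simp: in_arcsD2)
      then have "\<forall>x\<in>?N u. \<forall>y\<in>?N u. x = y"
        using le[of u] card_le_Suc0_iff_eq[OF fin[of u]] by simp
      then show ?thesis
        using sym[OF that] by blast
    qed
    then show "\<exists>C. v \<in> C \<and> finite C \<and> card C \<le> 2 \<and>
        {(x, y) \<in> parcs G. f x = f y} `` C \<subseteq> C"
      using le[OF v] fin[of v] card_insert_le_m1[of 2 "?N v" v]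
      by (intro exI[of _ "insert v (?N v)"]) fastforce
  qed
qed

text \<open>A centre in \<open>D\<close> has either at most three neighbours, all leaves, or one
  neighbour in \<open>D\<close> and at most one leaf. The components are therefore single vertices,
  single edges, stars with at most three leaves, or paths with at most four vertices.\<close>

lemma double_star_components:
  assumes M: "sym M" "M \<subseteq> V \<times> V" "finite V"
    and leaf: "\<And>v. v \<in> V - D \<Longrightarrow> card (M `` {v}) \<le> 1"
    and centre: "\<And>v. v \<in> V \<inter> D \<Longrightarrow> card (M `` {v}) + card (M `` {v} \<inter> D) \<le> 3"
    and v: "v \<in> V"
  shows "\<exists>C. v \<in> C \<and> finite C \<and> card C \<le> 4 \<and> M `` C \<subseteq> C"
proof -
  have fin: "finite (M `` {x})" for x
    using M(2,3) finite_subset[of "M `` {x}" V] by auto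
  have sym: "(y, x) \<in> M" if "(x, y) \<in> M" for x y
    using M(1) that by (rule symD)
  have leafD: "y = x" if "(x, u) \<in> M" "u \<notin> D" "(u, y) \<in> M" for x u y
    using leaf[of u] that sym[OF that(1)] M(2) fin[of u] card_le_Suc0_iff_eq[of "M `` {u}"] by auto
  \<comment> \<open>The set \<open>C\<close> includes the neighbours of \<open>d\<close>, so that it
    also serves for a leaf attached to \<open>d\<close>.\<close>
  have centre_case: "\<exists>C. insert d (M `` {d}) \<subseteq> C \<and> finite C \<and> card C \<le> 4 \<and> M `` C \<subseteq> C"
    if d: "d \<in> V \<inter> D" for d
  proof (cases "M `` {d} \<inter> D = {}")
    case True
    have "M `` insert d (M `` {d}) \<subseteq> insert d (M `` {d})"
      using True leafD[of d] by blast
    moreover have "card (insert d (M `` {d})) \<le> 4"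
      using centre[OF d] card_insert_le_m1[of 4 "M `` {d}" d] by simp
    ultimately show ?thesis
      using fin by (intro exI[of _ "insert d (M `` {d})"]) auto
  next
    case False
    then obtain e where e: "(d, e) \<in> M" "e \<in> D"
      by auto
    \<comment> \<open>Neighbours in \<open>D\<close> count twice, so a bound of 3 permits only one
      of them and at most one further neighbour.\<close>
    have two: "card (M `` {x}) \<le> 2" "M `` {x} \<inter> D = {y}" if "(x, y) \<in> M" "x \<in> D" "y \<in> D" for x y
    proof -
      have c: "card (M `` {x}) + card (M `` {x} \<inter> D) \<le> 3"
        using that M(2) centre[of x] by auto
      have y: "y \<in> M `` {x} \<inter> D"
        using that by auto
      then have "card (M `` {x} \<inter> D) \<noteq> 0"
        using fin[of x] by (metis card_0_eq emptyE finite_Int)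
      moreover have "card (M `` {x} \<inter> D) \<le> card (M `` {x})"
        using fin[of x] by (intro card_mono) auto
      ultimately have "card (M `` {x}) \<le> 2" "card (M `` {x} \<inter> D) = 1"
        using c by linarith+
      then show "card (M `` {x}) \<le> 2" "M `` {x} \<inter> D = {y}"
        using y by (metis card_1_singletonE singletonD)+
    qed
    note d2 = two[OF e(1) _ e(2)] and e2 = two[OF sym[OF e(1)] e(2)]
    \<comment> \<open>A neighbour of one centre other than the opposite centre is a leaf, and a leaf
      only leads back.\<close>
    have "z \<in> M `` {d} \<union> M `` {e}"
      if "(x, y) \<in> M" "(y, z) \<in> M" "x = d \<and> y \<noteq> e \<or> x = e \<and> y \<noteq> d" for x y z
    proof -
      have "y \<notin> D"
        using that(1,3) d d2(2) e2(2) by auto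
      then have "z = x"
        using leafD that(1,2) by blast
      then show ?thesis
        using that(3) e(1) sym[OF e(1)] by auto
    qed
    then have "M `` (M `` {d} \<union> M `` {e}) \<subseteq> M `` {d} \<union> M `` {e}"
      by (auto; metis Image_singleton_iff Un_iff)
    moreover have "card (M `` {d} \<union> M `` {e}) \<le> 4"
      using card_Un_le[of "M `` {d}" "M `` {e}"] d d2(1) e2(1) by simp
    ultimately show ?thesis
      using fin sym[OF e(1)] by (intro exI[of _ "M `` {d} \<union> M `` {e}"]) auto
  qed
  show ?thesis
  proof (cases "v \<in> D")
    case True
    then show ?thesis
      using centre_case[of v] v by blast
  next
    case nD: False
    show ?thesis
    proof (cases "M `` {v} \<inter> D = {}")
      case True
      have "M `` insert v (M `` {v}) \<subseteq> insert v (M `` {v})"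
        using True leafD[of v] by blast
      moreover have "card (insert v (M `` {v})) \<le> 4"
        using leaf[of v] v nD card_insert_le_m1[of 4 "M `` {v}" v] by simp
      ultimately show ?thesis
        using fin by (intro exI[of _ "insert v (M `` {v})"]) auto
    next
      case False
      then obtain d where d: "(v, d) \<in> M" "d \<in> D"
        by auto
      then obtain C where "insert d (M `` {d}) \<subseteq> C" "finite C" "card C \<le> 4" "M `` C \<subseteq> C"
        using centre_case[of d] M(2) by auto
      then show ?thesis
        using sym[OF d(1)] by (intro exI[of _ C]) auto
    qed
  qed
qed

section \<open>Choosability of queue graphs\<close>

lemma queue_graph_defect_1:
  assumes k: "1 \<le> k" and G: "queue_graph k G"
  shows "choosable_with_defect TYPE('c) (3 * k) 1 G"
  unfolding choosable_with_defect_def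
proof (intro allI impI)
  fix L :: "'a \<Rightarrow> 'c set" assume L: "list_assignment (3 * k) G L"
  have "pair_graph G"
    using G by (simp add: queue_graph_def)
  then interpret pair_graph G .
  \<comment> \<open>Only roles 0 and 1 occur: \<open>Q 1 1 = 3\<close> and \<open>Q 1 0 = 2\<close>.
    An edge inside role 1 thus has weight 1 against the bound 2, and the density condition is three
    times the arc bound \<open>4 * k * card W\<close>. The formula for larger arguments just keeps
    \<open>Q\<close> symmetric.\<close>
  define Q :: "nat \<Rightarrow> nat \<Rightarrow> int"
    where "Q i j = (if i = 0 then 2 * int j else if j = 0 then 2 * int i else int i + int j + 1)" for i j
  have E: "parcs G \<inter> pverts G \<times> pverts G = parcs G"
    by (auto simp: in_arcsD1 in_arcsD2)
  have "\<exists>f \<rho>. \<forall>v\<in>pverts G. f v \<in> L v \<and> \<rho> v \<in> {1..1} \<and>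
    (\<Sum>u\<in>(parcs G \<inter> pverts G \<times> pverts G) `` {v}.
      if f u = f v then Q (\<rho> v) (\<rho> u) - Q (\<rho> v - 1) (\<rho> u) else 0) < Q (\<rho> v) 0 - Q (\<rho> v - 1) 0"
  proof (rule role_colouring)
    show "sym (parcs G)"
      using arcs_symmetric by (auto simp: sym_def)
    show "irrefl (parcs G)"
      using pair_no_loops by (fastforce simp: irrefl_def)
    show "Q 1 1 * int (card (parcs G \<inter> W \<times> W)) < 2 * (int (3 * k) * Q 1 0) * int (card W)"
      if W: "W \<subseteq> pverts G" "W \<noteq> {}" for W
    proof -
      have "int (3 * card (parcs G \<inter> W \<times> W)) < int (4 * (3 * k) * card W)"
        using queue_graph_sparse[OF k G W] by (simp only: of_nat_less_iff)
      then show ?thesis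
        by (simp add: Q_def)
    qed
    show "infinite (L v) \<or> 3 * k \<le> card (L v)" if "v \<in> pverts G" for v
      using L that by (simp add: list_assignment_def)
  qed (auto simp: Q_def pair_finite_verts)
  then obtain f \<rho> where f: "\<And>v. v \<in> pverts G \<Longrightarrow> f v \<in> L v" "\<And>v. v \<in> pverts G \<Longrightarrow> \<rho> v \<in> {1..1}"
    "\<And>v. v \<in> pverts G \<Longrightarrow> (\<Sum>u\<in>parcs G `` {v}.
      if f u = f v then Q (\<rho> v) (\<rho> u) - Q (\<rho> v - 1) (\<rho> u) else 0) < Q (\<rho> v) 0 - Q (\<rho> v - 1) 0"
    unfolding E by blast
  then have \<rho>: "\<rho> v = 1" if "v \<in> pverts G" for v
    using that by simp
  have "card {u. (v, u) \<in> parcs G \<and> f u = f v} \<le> 1" if v: "v \<in> pverts G" for v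
  proof -
    have fin: "finite (parcs G `` {v})"
      using pair_finite_verts by (rule finite_subset[rotated]) (auto simp: in_arcsD2)
    have "(\<Sum>u\<in>parcs G `` {v}. if f u = f v then 1 else 0) =
        (\<Sum>u\<in>parcs G `` {v}. if f u = f v then Q (\<rho> v) (\<rho> u) - Q (\<rho> v - 1) (\<rho> u) else 0)"
      using \<rho> v by (intro sum.cong) (auto simp: Q_def in_arcsD2)
    also have "\<dots> < 2"
      using f(3)[OF v] \<rho>[OF v] by (simp add: Q_def)
    finally have "(\<Sum>u\<in>parcs G `` {v}. if f u = f v then 1 else 0 :: int) < 2" .
    moreover have "(\<Sum>u\<in>parcs G `` {v}. if f u = f v then 1 else 0 :: int)
        = int (card {u \<in> parcs G `` {v}. f u = f v})"
      using fin by (simp add: sum.If_cases Int_def)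
    ultimately show ?thesis
      by simp
  qed
  then show "\<exists>f. list_colouring G L f \<and> has_defect G f 1"
    using f(1) by (auto simp: list_colouring_def has_defect_iff)
qed

text \<open>The roles 1 and 2 are D and X.\<close>

lemma queue_graph_clustering_4:
  assumes k: "1 \<le> k" and G: "queue_graph k G" and c: "8 * k \<le> 3 * c"
  shows "choosable_with_clustering TYPE('c) c 4 G"
  unfolding choosable_with_clustering_def
proof (intro allI impI)
  fix L :: "'a \<Rightarrow> 'c set" assume L: "list_assignment c G L"
  have "pair_graph G"
    using G by (simp add: queue_graph_def)
  then interpret pair_graph G .
  \<comment> \<open>The values are \<open>K 1 = 4\<close>, \<open>K 2 = 6\<close>,
    \<open>Q 1 1 = 6\<close>, \<open>Q 1 2 = 7\<close> and \<open>Q 2 2 = 8\<close>. The differences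
    \<open>Q i j - Q (i - 1) j\<close> are 2 for \<open>i = j = 1\<close> and 1 for the other pairs
    of positive roles; for \<open>j = 0\<close> they are 4 when \<open>i = 1\<close> and 2 when
    \<open>i = 2\<close>.\<close>
  define K :: "nat \<Rightarrow> int" where "K i = (if i = 0 then 0 else 2 * int i + 2)" for i
  define Q :: "nat \<Rightarrow> nat \<Rightarrow> int"
    where "Q i j = (if i = 0 then K j else if j = 0 then K i else int i + int j + 4)" for i j
  have E: "parcs G \<inter> pverts G \<times> pverts G = parcs G"
    by (auto simp: in_arcsD1 in_arcsD2)
  have role: "i \<in> {1..2} \<longleftrightarrow> i = 1 \<or> i = 2" "i \<in> {0..2} \<longleftrightarrow> i = 0 \<or> i = 1 \<or> i = 2" for i :: nat
    by auto
  have "\<exists>f \<rho>. \<forall>v\<in>pverts G. f v \<in> L v \<and> \<rho> v \<in> {1..2} \<and>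
    (\<Sum>u\<in>(parcs G \<inter> pverts G \<times> pverts G) `` {v}.
      if f u = f v then Q (\<rho> v) (\<rho> u) - Q (\<rho> v - 1) (\<rho> u) else 0) < Q (\<rho> v) 0 - Q (\<rho> v - 1) 0"
  proof (rule role_colouring)
    show "sym (parcs G)"
      using arcs_symmetric by (auto simp: sym_def)
    show "irrefl (parcs G)"
      using pair_no_loops by (fastforce simp: irrefl_def)
    show "Q 2 2 * int (card (parcs G \<inter> W \<times> W)) < 2 * (int c * Q 2 0) * int (card W)"
      if W: "W \<subseteq> pverts G" "W \<noteq> {}" for W
    proof -
      \<comment> \<open>The density condition reads \<open>8 * m < 12 * c * card W\<close> for
        \<open>m\<close> arcs; this is where \<open>8 * k \<le> 3 * c\<close> enters.\<close>
      have "8 * card (parcs G \<inter> W \<times> W) < 4 * (8 * k) * card W"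
        using queue_graph_sparse[OF k G W] by simp
      also have "\<dots> \<le> 4 * (3 * c) * card W"
        using c by (intro mult_right_mono mult_left_mono) auto
      finally have "int (8 * card (parcs G \<inter> W \<times> W)) < int (4 * (3 * c) * card W)"
        by (simp only: of_nat_less_iff)
      then show ?thesis
        by (simp add: Q_def K_def)
    qed
    show "infinite (L v) \<or> c \<le> card (L v)" if "v \<in> pverts G" for v
      using L that by (simp add: list_assignment_def)
  qed (auto simp: Q_def K_def role pair_finite_verts)
  then obtain f \<rho> where f: "\<And>v. v \<in> pverts G \<Longrightarrow> f v \<in> L v"
      "\<And>v. v \<in> pverts G \<Longrightarrow> \<rho> v = 1 \<or> \<rho> v = 2"
      "\<And>v. v \<in> pverts G \<Longrightarrow> (\<Sum>u\<in>parcs G `` {v}.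
      if f u = f v then Q (\<rho> v) (\<rho> u) - Q (\<rho> v - 1) (\<rho> u) else 0) < Q (\<rho> v) 0 - Q (\<rho> v - 1) 0"
    unfolding E role by blast
  define M where "M = {(x, y) \<in> parcs G. f x = f y}"
  define D where "D = {v \<in> pverts G. \<rho> v = 1}"
  have fin: "finite (parcs G `` {v})" for v
    using pair_finite_verts by (rule finite_subset[rotated]) (auto simp: in_arcsD2)
  have M_eq: "M `` {v} = {u \<in> parcs G `` {v}. f u = f v}" for v
    by (auto simp: M_def)
  have finM: "finite (M `` {v})" for v
    by (rule finite_subset[OF _ fin[of v]]) (auto simp: M_def)
  have sum_M: "(\<Sum>u\<in>parcs G `` {v}. if f u = f v then h u else 0) = (\<Sum>u\<in>M `` {v}. h u)"
    for v and h :: "'a \<Rightarrow> int"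
  proof -
    have "(\<Sum>u\<in>parcs G `` {v}. if f u = f v then h u else 0) = sum h {u \<in> parcs G `` {v}. f u = f v}"
      using fin[of v] by (simp only: sum.inter_filter)
    then show ?thesis
      by (simp only: M_eq)
  qed
  have MV: "M \<subseteq> pverts G \<times> pverts G"
    by (auto simp: M_def in_arcsD1 in_arcsD2)
  have "has_clustering G f 4"
  proof (rule has_clusteringI, fold M_def, rule double_star_components)
    show "sym M"
      using arcs_symmetric by (auto simp: M_def sym_def)
    show "M \<subseteq> pverts G \<times> pverts G" "finite (pverts G)"
      by (fact MV pair_finite_verts)+
    show "card (M `` {v}) \<le> 1" if "v \<in> pverts G - D" for v
    proof -
      have v: "v \<in> pverts G" "\<rho> v = 2"
        using that f(2)[of v] by (auto simp: D_def)
      \<comment> \<open>At role 2 every monochromatic neighbour weighs 1, and the total is below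
        2.\<close>
      have "(\<Sum>u\<in>M `` {v}. Q 2 (\<rho> u) - Q 1 (\<rho> u)) < 2"
        using f(3)[OF v(1)] v(2) by (simp add: sum_M Q_def K_def)
      moreover have "(\<Sum>u\<in>M `` {v}. Q 2 (\<rho> u) - Q 1 (\<rho> u)) = (\<Sum>u\<in>M `` {v}. 1)"
        using MV f(2) by (intro sum.cong) (fastforce simp: Q_def K_def)+
      ultimately show ?thesis
        by simp
    qed
    show "card (M `` {v}) + card (M `` {v} \<inter> D) \<le> 3" if "v \<in> pverts G \<inter> D" for v
    proof -
      have v: "v \<in> pverts G" "\<rho> v = 1"
        using that by (auto simp: D_def)
      \<comment> \<open>At role 1 the total is below 4, and neighbours in \<open>D\<close> weigh 2
        instead of 1.\<close>
      have "(\<Sum>u\<in>M `` {v}. Q 1 (\<rho> u) - Q 0 (\<rho> u)) < 4"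
        using f(3)[OF v(1)] v(2) by (simp add: sum_M Q_def K_def)
      moreover have "(\<Sum>u\<in>M `` {v}. Q 1 (\<rho> u) - Q 0 (\<rho> u))
          = (\<Sum>u\<in>M `` {v}. 1 + (if u \<in> D then 1 else 0))"
        using MV f(2) by (intro sum.cong) (fastforce simp: Q_def K_def D_def)+
      moreover have "\<dots> = int (card (M `` {v})) + int (card (M `` {v} \<inter> D))"
        using finM by (simp add: sum.distrib sum.If_cases)
      ultimately show ?thesis
        by simp
    qed
  qed
  then show "\<exists>f. list_colouring G L f \<and> has_clustering G f 4"
    using f(1) by (auto simp: list_colouring_def)
qed

lemma choosable_with_clustering_mono:
  "choosable_with_clustering TYPE('c) k c G \<Longrightarrow> c \<le> d \<Longrightarrow> choosable_with_clustering TYPE('c) k d G"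
  unfolding choosable_with_clustering_def has_clustering_def by (meson order_trans)

theorem theorem28:
  fixes G :: "'a pair_pre_digraph" and k :: nat
  assumes "k \<ge> 1"
    and "queue_graph k G"
  shows "choosable_with_defect TYPE('c) (3 * k) 1 G
    \<and> choosable_with_clustering TYPE('c) (3 * k) 2 G
    \<and> choosable_with_clustering TYPE('c) (nat \<lfloor>(14 * real k + 4) / 5\<rfloor>) 9 G
    \<and> choosable_with_clustering TYPE('c) (nat \<lfloor>(8 * real k + 2) / 3\<rfloor>) (152 * k - 13) G"
proof (intro conjI)
  show defect: "choosable_with_defect TYPE('c) (3 * k) 1 G"
    using assms by (rule queue_graph_defect_1)
  then show "choosable_with_clustering TYPE('c) (3 * k) 2 G"
    using assms(2) defect_1_imp_clustering_2
    unfolding choosable_with_defect_def choosable_with_clustering_def queue_graph_def by metis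
  \<comment> \<open>The summand 4 turns the floor into the ceiling of \<open>14 * k / 5\<close>,
    which is at least \<open>8 * k / 3\<close>.\<close>
  have "\<lfloor>(14 * real k + 4) / 5\<rfloor> = (14 * int k + 4) div 5"
    using floor_divide_of_int_eq[of "14 * int k + 4" 5, where ?'a = real] by simp
  then have "8 * k \<le> 3 * nat \<lfloor>(14 * real k + 4) / 5\<rfloor>"
    by linarith
  then show "choosable_with_clustering TYPE('c) (nat \<lfloor>(14 * real k + 4) / 5\<rfloor>) 9 G"
    by (intro choosable_with_clustering_mono[OF queue_graph_clustering_4[OF assms]]) auto
  \<comment> \<open>This is the ceiling of \<open>8 * k / 3\<close>, the least list size that
    \<open>queue_graph_clustering_4\<close> admits.\<close>
  have "\<lfloor>(8 * real k + 2) / 3\<rfloor> = (8 * int k + 2) div 3"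
    using floor_divide_of_int_eq[of "8 * int k + 2" 3, where ?'a = real] by simp
  then have "8 * k \<le> 3 * nat \<lfloor>(8 * real k + 2) / 3\<rfloor>"
    by linarith
  \<comment> \<open>For \<open>k \<ge> 1\<close> the truncated difference
    \<open>152 * k - 13\<close> is at least 139, hence above 4.\<close>
  then show "choosable_with_clustering TYPE('c) (nat \<lfloor>(8 * real k + 2) / 3\<rfloor>) (152 * k - 13) G"
    using assms(1)
    by (intro choosable_with_clustering_mono[OF queue_graph_clustering_4[OF assms]]) auto
qed

end
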